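(* The set $\Lambda'$ of all words $t^{k_0}{t'_1}^{k_1}\cdots {t'_m}^{k_m}$ with $m\ge 0$ and all $k_i\in\mathbb{Z}\setminus\{0\}$, equipped with the ordering $<$ described in the context, is a totally ordered set.
   Context: Elements of $\Lambda'$ are regarded as formal words, i.e. the word $t^{k_0}{t'_1}^{k_1}\cdots {t'_m}^{k_m}$ (with $t=t'_0$) is determined by the finite nonempty tuple $(k_0,\dots,k_m)$ of nonzero integers. The index of such a word $w$ is $ind(w)=m$, the highest index of a generator occurring in it. The ordering: let $w=t^{k_0}{t'_1}^{k_1}\cdots {t'_m}^{k_m}$ and $\sigma=t^{\lambda_0}{t'_1}^{\lambda_1}\cdots {t'_n}^{\lambda_n}$ be in $\Lambda'$. (a) If $\sum_{i=0}^m k_i<\sum_{i=0}^n\lambda_i$, then $w<\sigma$. (b) If $\sum_{i=0}^m k_i=\sum_{i=0}^n\lambda_i$, then: (i) if $ind(w)<ind(\sigma)$, then $w<\sigma$; (ii) if $ind(w)=ind(\sigma)=m$, then: - if for some $i$ we have $k_m=\lambda_m,\ k_{m-1}=\lambda_{m-1},\dots,k_{i+1}=\lambda_{i+1}$ and $|k_i|<|\lambda_i|$, then $w<\sigma$; - if for some $i$ we have $k_m=\lambda_m,\dots,k_{i+1}=\lambda_{i+1}$, $|k_i|=|\lambda_i|$ and $k_i>\lambda_i$, then $w<\sigma$; - if $k_i=\lambda_i$ for all $i$, then $w=\sigma$. *)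

theory Defs
  imports Main
begin

text \<open>A formal word with exponents k_0, ..., k_m of t = t'_0, t'_1, ..., t'_m is the list
  [k_0, ..., k_m]; equality of words is equality of lists.\<close>

type_synonym word = "int list"

definition Lambda' :: "word set" where
  "Lambda' = {w. w \<noteq> [] \<and> (\<forall>k \<in> set w. k \<noteq> 0)}"

definition ind :: "word \<Rightarrow> nat" where
  "ind w = length w - 1"

text \<open>The clauses \<open>abs_less\<close> and \<open>abs_eq\<close> compare two words of the same index m at a position
  i above which (i < j, up to m) the exponents agree; the larger exponent gives the smaller word
  when the absolute values are equal.\<close>

inductive word_less :: "word \<Rightarrow> word \<Rightarrow> bool" where
  sum_less:
    "\<lbrakk>w \<in> Lambda'; s \<in> Lambda'; (\<Sum>i\<le>ind w. w ! i) < (\<Sum>i\<le>ind s. s ! i)\<rbrakk> \<Longrightarrow> word_less w s"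
| ind_less:
    "\<lbrakk>w \<in> Lambda'; s \<in> Lambda'; (\<Sum>i\<le>ind w. w ! i) = (\<Sum>i\<le>ind s. s ! i);
      ind w < ind s\<rbrakk> \<Longrightarrow> word_less w s"
| abs_less:
    "\<lbrakk>w \<in> Lambda'; s \<in> Lambda'; (\<Sum>i\<le>ind w. w ! i) = (\<Sum>i\<le>ind s. s ! i);
      ind w = ind s; i \<le> ind w; \<forall>j. i < j \<and> j \<le> ind w \<longrightarrow> w ! j = s ! j;
      \<bar>w ! i\<bar> < \<bar>s ! i\<bar>\<rbrakk> \<Longrightarrow> word_less w s"
| abs_eq:
    "\<lbrakk>w \<in> Lambda'; s \<in> Lambda'; (\<Sum>i\<le>ind w. w ! i) = (\<Sum>i\<le>ind s. s ! i);
      ind w = ind s; i \<le> ind w; \<forall>j. i < j \<and> j \<le> ind w \<longrightarrow> w ! j = s ! j;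
      \<bar>w ! i\<bar> = \<bar>s ! i\<bar>; w ! i > s ! i\<rbrakk> \<Longrightarrow> word_less w s"

end

theory Submission
  imports Defs
begin

text \<open>The exponents are ordered as \<open>1, -1, 2, -2, \<dots>\<close>, and \<open>exponent_rank\<close> is an injection into
  the integers that realises this order. The order on words is then lexicographic: first the
  exponent sum, then the index, then the ranks of the exponents read from the highest generator
  downwards.\<close>

definition exponent_rank :: "int \<Rightarrow> int" where
  "exponent_rank k = 2 * \<bar>k\<bar> + (if k < 0 then 1 else 0)"

text \<open>Doubling leaves a gap of two between different absolute values, which the sign bit
  cannot bridge; it only breaks ties.\<close>

lemma exponent_rank_less_iff:
  "exponent_rank a < exponent_rank b \<longleftrightarrow> \<bar>a\<bar> < \<bar>b\<bar> \<or> \<bar>a\<bar> = \<bar>b\<bar> \<and> a > b"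
  unfolding exponent_rank_def by (auto split: if_splits)

text \<open>Halving the rank recovers the absolute value, and its parity recovers the sign.\<close>

lemma exponent_rank_eq_iff: "exponent_rank a = exponent_rank b \<longleftrightarrow> a = b"
  unfolding exponent_rank_def by (auto split: if_splits; presburger)

text \<open>Intended for words of equal index, which is assumed separately wherever it matters. The
  rank merges the clauses \<open>abs_less\<close> and \<open>abs_eq\<close> into one.\<close>

definition exponents_less :: "word \<Rightarrow> word \<Rightarrow> bool" where
  "exponents_less w s \<longleftrightarrow> (\<exists>i\<le>ind w. (\<forall>j. i < j \<and> j \<le> ind w \<longrightarrow> w ! j = s ! j) \<and>
     exponent_rank (w ! i) < exponent_rank (s ! i))"

lemma exponents_less_irrefl: "\<not> exponents_less w w"
  by (simp add: exponents_less_def)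

lemma exponents_less_trans:
  assumes "exponents_less u v" "exponents_less v w" "ind u = ind v"
  shows "exponents_less u w"
proof -
  obtain i where i: "i \<le> ind u" "\<And>j. i < j \<Longrightarrow> j \<le> ind u \<Longrightarrow> u ! j = v ! j"
    "exponent_rank (u ! i) < exponent_rank (v ! i)"
    using assms(1) by (auto simp: exponents_less_def)
  obtain k where k: "k \<le> ind u" "\<And>j. k < j \<Longrightarrow> j \<le> ind u \<Longrightarrow> v ! j = w ! j"
    "exponent_rank (v ! k) < exponent_rank (w ! k)"
    using assms(2,3) by (auto simp: exponents_less_def)
  \<comment> \<open>Above \<open>max i k\<close> all three words agree. At this position at least
    one of the two comparisons is strict, and the other is strict or an equality.\<close>
  have "exponent_rank (u ! max i k) < exponent_rank (w ! max i k)"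
    using i k by (cases i k rule: linorder_cases) auto
  then show ?thesis
    unfolding exponents_less_def using i k by (intro exI[of _ "max i k"]) auto
qed

text \<open>Words are nonempty, so the truncated subtraction in \<open>ind\<close> is exact.\<close>

lemma Lambda'_length: "w \<in> Lambda' \<Longrightarrow> length w = Suc (ind w)"
  by (cases w) (auto simp: Lambda'_def ind_def)

lemma exponents_less_total:
  assumes "w \<in> Lambda'" "s \<in> Lambda'" "ind w = ind s" "w \<noteq> s"
  shows "exponents_less w s \<or> exponents_less s w"
proof -
  define D where "D = {j. j \<le> ind w \<and> w ! j \<noteq> s ! j}"
  have fin: "finite D"
    unfolding D_def by simp
  \<comment> \<open>Equal indices give equal lengths, so distinct words must differ at some
    position; the highest one decides.\<close>
  have "D \<noteq> {}"
    using assms Lambda'_length nth_equalityI[of w s] unfolding D_def by fastforce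
  then have D: "Max D \<le> ind w" "w ! Max D \<noteq> s ! Max D"
    using Max_in[OF fin] unfolding D_def by auto
  have "w ! j = s ! j" if "Max D < j" "j \<le> ind w" for j
    using Max_ge[OF fin, of j] that leD unfolding D_def by blast
  moreover have "exponent_rank (w ! Max D) \<noteq> exponent_rank (s ! Max D)"
    using D by (simp add: exponent_rank_eq_iff)
  ultimately show ?thesis
    unfolding exponents_less_def using D assms(3) by (metis linorder_neqE)
qed

definition exponent_sum :: "word \<Rightarrow> int" where
  "exponent_sum w = (\<Sum>i\<le>ind w. w ! i)"

text \<open>No rule of \<open>word_less\<close> is recursive, so unfolding gives a plain disjunction
  of the four clauses; the last two are the two cases of
  \<open>exponent_rank_less_iff\<close>.\<close>

lemma word_less_iff:
  "word_less w s \<longleftrightarrow> w \<in> Lambda' \<and> s \<in> Lambda' \<and>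
    (exponent_sum w < exponent_sum s \<or> exponent_sum w = exponent_sum s \<and>
      (ind w < ind s \<or> ind w = ind s \<and> exponents_less w s))"
  unfolding word_less.simps exponents_less_def exponent_rank_less_iff exponent_sum_def by auto

lemma word_less_irrefl: "\<not> word_less w w"
  by (simp add: word_less_iff exponents_less_irrefl)

lemma word_less_trans: "word_less u v \<Longrightarrow> word_less v w \<Longrightarrow> word_less u w"
  using exponents_less_trans[of u v w] by (auto simp: word_less_iff)

lemma word_less_total:
  "w \<in> Lambda' \<Longrightarrow> s \<in> Lambda' \<Longrightarrow> w \<noteq> s \<Longrightarrow> word_less w s \<or> word_less s w"
  using exponents_less_total[of w s] unfolding word_less_iff by fastforce

theorem proposition1:
  shows "strict_linear_order_on Lambda' {(w, s). word_less w s} \<and>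
    linear_order_on Lambda' ({(w, s). word_less w s} \<union> Id_on Lambda')"
proof
  show strict: "strict_linear_order_on Lambda' {(w, s). word_less w s}"
    unfolding strict_linear_order_on_def trans_def irrefl_def total_on_def
    using word_less_irrefl word_less_trans word_less_total by blast
  have field: "word_less w s \<Longrightarrow> w \<in> Lambda' \<and> s \<in> Lambda'" for w s
    by (simp add: word_less_iff)
  show "linear_order_on Lambda' ({(w, s). word_less w s} \<union> Id_on Lambda')"
    unfolding linear_order_on_def partial_order_on_def preorder_on_def
  proof (intro conjI)
    \<comment> \<open>Opposite strict comparisons would compose to
      \<open>word_less w w\<close>.\<close>
    show "antisym ({(w, s). word_less w s} \<union> Id_on Lambda')"
      unfolding antisym_def using word_less_irrefl word_less_trans by blast
    show "trans ({(w, s). word_less w s} \<union> Id_on Lambda')"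
      unfolding trans_def using word_less_trans by blast
    show "total_on Lambda' ({(w, s). word_less w s} \<union> Id_on Lambda')"
      unfolding total_on_def using word_less_total by blast
  qed (use field in \<open>auto simp: refl_on_def\<close>)
qed

end
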